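(* Let $G_1$ and $G_2$ be abelian groups and suppose that $G_1$ is a direct sum of cyclic groups. Then the groups $G_1$ and $G_2$ are isomorphic if and only if their monoids of plus-minus weighted zero-sum sequences $\mathcal{B}_{\pm}(G_1)$ and $\mathcal{B}_{\pm}(G_2)$ are isomorphic.
   Context: Groups are written additively. For an abelian group $G$, $\mathcal{F}(G)$ is the multiplicatively written free abelian monoid with basis $G$; its elements $S=g_1\cdot\ldots\cdot g_\ell$ (finite unordered sequences with repetition allowed) are called sequences over $G$. $\mathcal{B}_{\pm}(G)\subset\mathcal{F}(G)$ is the submonoid of all plus-minus weighted zero-sum sequences, i.e. all $S=g_1\cdot\ldots\cdot g_\ell$ for which there are $\varepsilon_1,\ldots,\varepsilon_\ell\in\{-1,1\}$ with $\varepsilon_1g_1+\ldots+\varepsilon_\ell g_\ell=0$ in $G$ (the empty sequence is included). The monoids are considered as abstract monoids, up to monoid isomorphism. The direct sum may have arbitrarily (possibly infinitely) many cyclic summands, finite or infinite. *)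

theory Defs
  imports "HOL-Algebra.Algebra" "HOL-Library.Multiset"
begin

text \<open>
  Abelian groups are \<open>comm_group\<close> structures, whose operation is written multiplicatively in
  HOL-Algebra; so \<open>\<otimes>\<close>, \<open>\<one>\<close> and \<open>[^]\<close> below stand for the sum, zero and integer multiple.
  The free abelian monoid with basis \<open>carrier G\<close> consists of the finite multisets over
  \<open>carrier G\<close> under multiset union.
\<close>

definition free_abelian_monoid :: "('a, 'b) monoid_scheme \<Rightarrow> 'a multiset monoid" where
  "free_abelian_monoid G =
     \<lparr>carrier = {S. set_mset S \<subseteq> carrier G}, monoid.mult = (+), one = {#}\<rparr>"

definition pm_zero_sum :: "('a, 'b) monoid_scheme \<Rightarrow> 'a multiset \<Rightarrow> bool" where
  "pm_zero_sum G S \<longleftrightarrow>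
     (\<exists>gs \<epsilon>. S = mset gs \<and> \<epsilon> \<in> {..<length gs} \<rightarrow> {-1, 1 :: int} \<and>
        finprod G (\<lambda>i. (gs ! i) [^]\<^bsub>G\<^esub> \<epsilon> i) {..<length gs} = \<one>\<^bsub>G\<^esub>)"

definition pm_zero_sum_monoid :: "('a, 'b) monoid_scheme \<Rightarrow> 'a multiset monoid" where
  "pm_zero_sum_monoid G =
     free_abelian_monoid G \<lparr>carrier := {S \<in> carrier (free_abelian_monoid G). pm_zero_sum G S}\<rparr>"

end

theory Submission
  imports Defs
begin

text \<open>
  Isomorphic groups obviously have isomorphic monoids \<open>\<B>\<^sub>\<plusminus>\<close>; the content is the converse. Let
  \<open>\<phi>\<close> be an isomorphism from \<open>\<B>\<^sub>\<plusminus>(G)\<close> to \<open>\<B>\<^sub>\<plusminus>(H)\<close>. The groups are recovered in two steps.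

  \<^bold>\<open>From monoids to bijections.\<close> The square \<open>S\<^sup>2\<close> of every sequence \<open>S\<close> is a plus-minus weighted
  zero-sum sequence, because the two copies of each term can be given opposite signs. Hence a
  member \<open>A\<close> of the monoid is a subsequence of a member \<open>C\<close> exactly when \<open>A\<^sup>2\<close> divides \<open>C\<^sup>2\<close>
  inside the monoid, so \<open>\<phi>\<close> preserves the relation of being a subsequence. It follows that
  \<open>\<phi>(g\<^sup>2)\<close> is a power of a single element \<open>f(g)\<close>, and that \<open>f\<close> is a bijection of the groups.
  Comparison with the inverse of \<open>\<phi>\<close> shows that this power is again a square, unless \<open>\<phi>\<close> moves
  the one-term sequence \<open>0\<close>. In the latter case, both groups have two elements and are isomorphic for that
  reason. Otherwise, \<open>\<phi>\<close> agrees on squares with the termwise application of \<open>f\<close>, and hence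
  everywhere, so a sequence \<open>S\<close> has a signed zero sum if and only if \<open>f(S)\<close> has one.

  \<^bold>\<open>From bijections to homomorphisms.\<close> Reading this equivalence for the three-term sequences shows
  that \<open>f\<close> carries the set of all \<open>\<plusminus>x \<plusminus> y\<close> onto the set of all \<open>\<plusminus>f(x) \<plusminus> f(y)\<close>. An induction gives
  \<open>f(n x) = \<plusminus>n f(x)\<close> for all integers \<open>n\<close>, so on a cyclic subgroup \<open>f\<close> agrees up to sign with a
  homomorphism. If \<open>G\<close> is the direct sum of cyclic groups \<open>C\<^sub>i\<close>, let \<open>h\<^sub>i\<close> be such a homomorphism on
  \<open>C\<^sub>i\<close> and let \<open>\<theta>\<close> be the sum of all \<open>h\<^sub>i\<close>. The signs that relate \<open>f\<close> and \<open>\<theta>\<close> can be moved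
  into the coordinates of the argument: for every \<open>x\<close> there are \<open>y\<close> and \<open>z\<close> which arise from \<open>x\<close> by
  changing signs of coordinates such that \<open>\<theta>(y) = f(x)\<close> and \<open>f(z) = \<theta>(x)\<close>. As \<open>f\<close> is
  surjective, so is \<open>\<theta>\<close>; as only \<open>0\<close> is mapped to \<open>0\<close> by \<open>f\<close>, the kernel of \<open>\<theta>\<close> is trivial.
  Hence \<open>\<theta>\<close> is an isomorphism.
\<close>

section \<open>Values of signed sums\<close>

abbreviation signed_pair :: "('a, 'b) monoid_scheme \<Rightarrow> 'a \<Rightarrow> 'a \<Rightarrow> 'a set" where
  "signed_pair G x y \<equiv> {x \<otimes>\<^bsub>G\<^esub> y, x \<otimes>\<^bsub>G\<^esub> inv\<^bsub>G\<^esub> y,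
    inv\<^bsub>G\<^esub> x \<otimes>\<^bsub>G\<^esub> y, inv\<^bsub>G\<^esub> x \<otimes>\<^bsub>G\<^esub> inv\<^bsub>G\<^esub> y}"

text \<open>
  A sequence has a signed zero sum if and only if \<open>\<one>\<close> is among the values of all its signed sums.
  These values are computed one term at a time. Both the element and the result are cut down to the
  carrier so that the steps for different terms commute without any assumption, as folding over a
  multiset requires.
\<close>

definition (in comm_group) signed_step :: "'a \<Rightarrow> 'a set \<Rightarrow> 'a set" where
  "signed_step g V = {w \<in> carrier G. g \<in> carrier G \<and> (g \<otimes> w \<in> V \<or> inv g \<otimes> w \<in> V)}"

definition (in comm_group) signed_products :: "'a multiset \<Rightarrow> 'a set" where
  "signed_products S = fold_mset signed_step {\<one>} S"

context comm_group
begin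

lemma comp_fun_commute_signed_step: "comp_fun_commute signed_step"
proof
  show "signed_step h \<circ> signed_step g = signed_step g \<circ> signed_step h" for g h
    unfolding signed_step_def fun_eq_iff comp_def by (auto simp: m_lcomm)
qed

lemma signed_products_empty [simp]: "signed_products {#} = {\<one>}"
  by (simp add: signed_products_def)

lemma signed_products_add_mset [simp]:
  "signed_products (add_mset g S) = signed_step g (signed_products S)"
  by (simp add: signed_products_def comp_fun_commute.fold_mset_add_mset[OF comp_fun_commute_signed_step])

lemma signed_products_closed: "w \<in> signed_products S \<Longrightarrow> w \<in> carrier G"
  by (cases S) (auto simp: signed_step_def)

text \<open>
  The link to the defining formula with a choice of signs along an enumeration. Induction from the
  right fits here since the index set of the longer product is then \<open>{..<n}\<close> with \<open>n\<close> added.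
\<close>

lemma signed_products_mset_iff:
  assumes "set gs \<subseteq> carrier G"
  shows "w \<in> signed_products (mset gs) \<longleftrightarrow>
    (\<exists>\<epsilon>. \<epsilon> \<in> {..<length gs} \<rightarrow> {-1, 1 :: int} \<and>
       finprod G (\<lambda>i. (gs ! i) [^] \<epsilon> i) {..<length gs} = w)"
  using assms
proof (induction gs arbitrary: w rule: rev_induct)
  case Nil
  then show ?case by auto
next
  case (snoc g gs)
  let ?n = "length gs"
  have g: "g \<in> carrier G" and gs: "set gs \<subseteq> carrier G"
    using snoc.prems by auto
  have split: "finprod G (\<lambda>i. ((gs @ [g]) ! i) [^] \<epsilon> i) {..<length (gs @ [g])} =
      g [^] \<epsilon> ?n \<otimes> finprod G (\<lambda>i. (gs ! i) [^] \<epsilon> i) {..<?n}" for \<epsilon> :: "nat \<Rightarrow> int"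
  proof -
    have "finprod G (\<lambda>i. ((gs @ [g]) ! i) [^] \<epsilon> i) (insert ?n {..<?n}) =
      g [^] \<epsilon> ?n \<otimes> finprod G (\<lambda>i. ((gs @ [g]) ! i) [^] \<epsilon> i) {..<?n}"
      using g gs by (subst finprod_insert) (auto simp: nth_append subset_iff)
    also have "finprod G (\<lambda>i. ((gs @ [g]) ! i) [^] \<epsilon> i) {..<?n} = finprod G (\<lambda>i. (gs ! i) [^] \<epsilon> i) {..<?n}"
      using gs by (intro finprod_cong) (auto simp: nth_append simp_implies_def subset_iff)
    finally show ?thesis by (simp add: lessThan_Suc)
  qed
  have closed: "finprod G (\<lambda>i. (gs ! i) [^] \<epsilon> i) {..<?n} \<in> carrier G" for \<epsilon> :: "nat \<Rightarrow> int"
    using gs by (intro finprod_closed) (auto simp: subset_iff)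
  show ?case
  proof
    assume "w \<in> signed_products (mset (gs @ [g]))"
    then have w: "w \<in> carrier G" and "g \<otimes> w \<in> signed_products (mset gs) \<or> inv g \<otimes> w \<in> signed_products (mset gs)"
      by (auto simp: signed_step_def)
    then obtain e :: int where e: "e \<in> {-1, 1}" and "g [^] (- e) \<otimes> w \<in> signed_products (mset gs)"
      using g that[of 1] that[of "-1"] by (auto simp: int_pow_neg)
    then obtain \<epsilon> where \<epsilon>: "\<epsilon> \<in> {..<?n} \<rightarrow> {-1, 1 :: int}"
      and prod: "finprod G (\<lambda>i. (gs ! i) [^] \<epsilon> i) {..<?n} = g [^] (- e) \<otimes> w"
      using snoc.IH[OF gs] by auto
    have "finprod G (\<lambda>i. (gs ! i) [^] (\<epsilon>(?n := e)) i) {..<?n} = g [^] (- e) \<otimes> w"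
      unfolding prod[symmetric] using gs by (intro finprod_cong) (auto simp: simp_implies_def subset_iff)
    then have "finprod G (\<lambda>i. ((gs @ [g]) ! i) [^] (\<epsilon>(?n := e)) i) {..<length (gs @ [g])} = w"
      unfolding split using g w by (simp add: m_assoc[symmetric] int_pow_neg)
    then show "\<exists>\<epsilon>. \<epsilon> \<in> {..<length (gs @ [g])} \<rightarrow> {-1, 1 :: int} \<and>
       finprod G (\<lambda>i. ((gs @ [g]) ! i) [^] \<epsilon> i) {..<length (gs @ [g])} = w"
      using \<epsilon> e by (intro exI[of _ "\<epsilon>(?n := e)"]) (auto simp: Pi_iff less_Suc_eq)
  next
    assume "\<exists>\<epsilon>. \<epsilon> \<in> {..<length (gs @ [g])} \<rightarrow> {-1, 1 :: int} \<and>
       finprod G (\<lambda>i. ((gs @ [g]) ! i) [^] \<epsilon> i) {..<length (gs @ [g])} = w"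
    then obtain \<epsilon> where \<epsilon>: "\<epsilon> \<in> {..<Suc ?n} \<rightarrow> {-1, 1 :: int}"
      and w: "w = g [^] \<epsilon> ?n \<otimes> finprod G (\<lambda>i. (gs ! i) [^] \<epsilon> i) {..<?n}"
      unfolding split by auto
    let ?v = "finprod G (\<lambda>i. (gs ! i) [^] \<epsilon> i) {..<?n}"
    have "?v \<in> signed_products (mset gs)"
      unfolding snoc.IH[OF gs] using \<epsilon> by (intro exI[of _ \<epsilon>]) auto
    moreover have "\<epsilon> ?n \<in> {-1, 1}"
      using \<epsilon> by auto
    ultimately show "w \<in> signed_products (mset (gs @ [g]))"
      using g closed[of \<epsilon>] unfolding w
      by (auto simp: signed_step_def int_pow_neg m_assoc[symmetric])
  qed
qed

lemma pm_zero_sum_iff_signed_products: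
  assumes "set_mset S \<subseteq> carrier G"
  shows "pm_zero_sum G S \<longleftrightarrow> \<one> \<in> signed_products S"
proof
  assume "pm_zero_sum G S"
  then obtain gs \<epsilon> where "S = mset gs" "\<epsilon> \<in> {..<length gs} \<rightarrow> {-1, 1 :: int}"
      "finprod G (\<lambda>i. (gs ! i) [^] \<epsilon> i) {..<length gs} = \<one>"
    unfolding pm_zero_sum_def by blast
  with assms show "\<one> \<in> signed_products S"
    using signed_products_mset_iff[of gs \<one>] by auto
next
  assume "\<one> \<in> signed_products S"
  moreover obtain gs where gs: "mset gs = S"
    using ex_mset by blast
  ultimately have "\<exists>\<epsilon>. \<epsilon> \<in> {..<length gs} \<rightarrow> {-1, 1 :: int} \<and>
      finprod G (\<lambda>i. (gs ! i) [^] \<epsilon> i) {..<length gs} = \<one>"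
    using assms signed_products_mset_iff[of gs \<one>] by auto
  with gs show "pm_zero_sum G S"
    unfolding pm_zero_sum_def by blast
qed

lemma signed_products_plus:
  assumes "v \<in> signed_products A" "w \<in> signed_products B"
  shows "v \<otimes> w \<in> signed_products (A + B)"
  using assms
proof (induction A arbitrary: v)
  case empty
  then show ?case by (auto simp: signed_products_closed)
next
  case (add g A)
  then show ?case
    by (auto simp: signed_step_def signed_products_closed m_assoc[symmetric])
qed

lemma pm_zero_sum_plus:
  assumes "set_mset A \<subseteq> carrier G" "set_mset B \<subseteq> carrier G" "pm_zero_sum G A" "pm_zero_sum G B"
  shows "pm_zero_sum G (A + B)"
  using assms signed_products_plus[of \<one> A \<one> B] by (simp add: pm_zero_sum_iff_signed_products)

text \<open>
  The two copies of each term get opposite signs. This source of members of the monoid is what makes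
  the monoid large enough to determine the group.
\<close>

lemma pm_zero_sum_double:
  assumes "set_mset S \<subseteq> carrier G"
  shows "pm_zero_sum G (S + S)"
proof -
  have "\<one> \<in> signed_products (S + S)"
    using assms by (induction S) (auto simp: signed_step_def)
  with assms show ?thesis by (simp add: pm_zero_sum_iff_signed_products)
qed

text \<open>
  The sequences with at most three terms carry all information about the group that is used later:
  they detect the neutral element, equality up to sign, and addition up to signs.
\<close>

lemma pm_zero_sum_single_iff:
  assumes "x \<in> carrier G"
  shows "pm_zero_sum G {#x#} \<longleftrightarrow> x = \<one>"
  using assms by (auto simp: pm_zero_sum_iff_signed_products signed_step_def inv_eq_1_iff)

lemma pm_zero_sum_pair_iff:
  assumes "x \<in> carrier G" "y \<in> carrier G"
  shows "pm_zero_sum G {#x, y#} \<longleftrightarrow> y \<in> {x, inv x}"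
  using assms
  by (auto simp: pm_zero_sum_iff_signed_products signed_step_def inv_eq_1_iff inv_equality inv_solve_left' inv_solve_right')

lemma pm_zero_sum_triple_iff:
  assumes "x \<in> carrier G" "y \<in> carrier G" "z \<in> carrier G"
  shows "pm_zero_sum G {#z, x, y#} \<longleftrightarrow>
    z \<in> signed_pair G x y"
proof -
  have plain: "b \<otimes> (a \<otimes> z) = \<one> \<longleftrightarrow> z = inv a \<otimes> inv b"
    if "a \<in> carrier G" "b \<in> carrier G" for a b
    using that assms by (metis inv_mult_group inv_closed inv_equality inv_inv l_inv m_assoc m_closed)
  have inverted: "b \<otimes> (a \<otimes> inv z) = \<one> \<longleftrightarrow> z = a \<otimes> b"
    if "a \<in> carrier G" "b \<in> carrier G" for a b
    using that assms by (metis m_comm inv_mult_group inv_closed inv_equality inv_inv l_inv m_assoc m_closed)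
  show ?thesis
    using assms by (auto simp: pm_zero_sum_iff_signed_products signed_step_def plain inverted)
qed

end

section \<open>Isomorphisms between monoids of zero-sum sequences\<close>

lemma double_mset_cancel:
  fixes A B :: "'a multiset"
  assumes "A + A = B + B"
  shows "A = B"
proof (rule multiset_eqI)
  fix x
  have "count (A + A) x = count (B + B) x"
    using assms by simp
  then show "count A x = count B x" by simp
qed

lemma double_subset_mset_cancel:
  fixes A B :: "'a multiset"
  assumes "A + A \<subseteq># B + B"
  shows "A \<subseteq># B"
proof (rule mset_subset_eqI)
  fix x
  have "count (A + A) x \<le> count (B + B) x"
    using assms by (rule mset_subset_eq_count)
  then show "count A x \<le> count B x" by simp
qed

lemma repeat_mset_replicate: "repeat_mset m (replicate_mset n a) = replicate_mset (m * n) a"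
  by (rule multiset_eqI) simp

lemma carrier_pm_zero_sum_monoid:
  "carrier (pm_zero_sum_monoid G) = {S. set_mset S \<subseteq> carrier G \<and> pm_zero_sum G S}"
  by (auto simp: pm_zero_sum_monoid_def free_abelian_monoid_def)

lemma mult_pm_zero_sum_monoid [simp]: "A \<otimes>\<^bsub>pm_zero_sum_monoid G\<^esub> B = A + B"
  by (simp add: pm_zero_sum_monoid_def free_abelian_monoid_def)

lemma (in comm_group) pm_zero_sum_monoid_plus:
  assumes "A \<in> carrier (pm_zero_sum_monoid G)" "B \<in> carrier (pm_zero_sum_monoid G)"
  shows "A + B \<in> carrier (pm_zero_sum_monoid G)"
  using assms pm_zero_sum_plus by (auto simp: carrier_pm_zero_sum_monoid)

lemma (in comm_group) pm_zero_sum_monoid_double: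
  "set_mset S \<subseteq> carrier G \<Longrightarrow> S + S \<in> carrier (pm_zero_sum_monoid G)"
  using pm_zero_sum_double by (auto simp: carrier_pm_zero_sum_monoid)

lemma (in comm_group) pm_zero_sum_monoid_square:
  "g \<in> carrier G \<Longrightarrow> {#g, g#} \<in> carrier (pm_zero_sum_monoid G)"
  using pm_zero_sum_monoid_double[of "{#g#}"] by simp

lemma (in comm_group) pm_zero_sum_monoid_empty: "{#} \<in> carrier (pm_zero_sum_monoid G)"
  using pm_zero_sum_monoid_double[of "{#}"] by simp

lemma (in comm_group) pm_zero_sum_monoid_repeat:
  "A \<in> carrier (pm_zero_sum_monoid G) \<Longrightarrow> repeat_mset n A \<in> carrier (pm_zero_sum_monoid G)"
  by (induction n) (auto simp: pm_zero_sum_monoid_empty pm_zero_sum_monoid_plus)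

lemma (in comm_group) pm_zero_sum_monoid_single_iff:
  "{#g#} \<in> carrier (pm_zero_sum_monoid G) \<longleftrightarrow> g = \<one>"
  by (auto simp: carrier_pm_zero_sum_monoid pm_zero_sum_single_iff)

locale pm_iso = G: comm_group G + H: comm_group H
  for G :: "('a, 'x) monoid_scheme" (structure) and H :: "('b, 'y) monoid_scheme" (structure) +
  fixes \<phi> :: "'a multiset \<Rightarrow> 'b multiset"
  assumes iso: "\<phi> \<in> iso (pm_zero_sum_monoid G) (pm_zero_sum_monoid H)"
begin

abbreviation BG where "BG \<equiv> carrier (pm_zero_sum_monoid G)"
abbreviation BH where "BH \<equiv> carrier (pm_zero_sum_monoid H)"

lemma plus [simp]: "\<lbrakk>A \<in> BG; B \<in> BG\<rbrakk> \<Longrightarrow> \<phi> (A + B) = \<phi> A + \<phi> B"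
  using iso by (auto simp: iso_def hom_def)

lemma closed: "A \<in> BG \<Longrightarrow> \<phi> A \<in> BH"
  using iso by (auto simp: iso_def hom_def)

lemma inj: "\<lbrakk>A \<in> BG; B \<in> BG; \<phi> A = \<phi> B\<rbrakk> \<Longrightarrow> A = B"
  using iso by (auto simp: iso_def bij_betw_def inj_on_def)

lemma image_eq: "\<phi> ` BG = BH"
  using iso by (simp add: iso_def bij_betw_def)

lemma surj: "C \<in> BH \<Longrightarrow> \<exists>A\<in>BG. \<phi> A = C"
  using image_eq by (metis imageE)

lemma empty [simp]: "\<phi> {#} = {#}"
  using plus[of "{#}" "{#}"] G.pm_zero_sum_monoid_empty by simp

lemma eq_empty_iff: "A \<in> BG \<Longrightarrow> \<phi> A = {#} \<longleftrightarrow> A = {#}"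
  using inj[of A "{#}"] G.pm_zero_sum_monoid_empty by auto

lemma repeat: "A \<in> BG \<Longrightarrow> \<phi> (repeat_mset n A) = repeat_mset n (\<phi> A)"
  by (induction n) (auto simp: G.pm_zero_sum_monoid_repeat)

lemma inverse: "pm_iso H G (inv_into BG \<phi>)"
proof -
  have "inv_into BG \<phi> \<in> iso (pm_zero_sum_monoid H) (pm_zero_sum_monoid G)"
  proof (rule isoI)
    show bij: "bij_betw (inv_into BG \<phi>) BH BG"
      using iso by (auto simp: iso_def bij_betw_inv_into)
    show "inv_into BG \<phi> \<in> hom (pm_zero_sum_monoid H) (pm_zero_sum_monoid G)"
    proof (rule homI)
      show "inv_into BG \<phi> C \<in> BG" if "C \<in> BH" for C
        using bij that by (auto simp: bij_betw_def)
      fix C D assume "C \<in> BH" "D \<in> BH"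
      then obtain A B where "A \<in> BG" "B \<in> BG" "C = \<phi> A" "D = \<phi> B"
        using surj by metis
      moreover have "inv_into BG \<phi> (\<phi> S) = S" if "S \<in> BG" for S
        using that iso by (auto simp: iso_def bij_betw_def)
      ultimately show "inv_into BG \<phi> (C \<otimes>\<^bsub>pm_zero_sum_monoid H\<^esub> D) =
          inv_into BG \<phi> C \<otimes>\<^bsub>pm_zero_sum_monoid G\<^esub> inv_into BG \<phi> D"
        using G.pm_zero_sum_monoid_plus[of A B] by (simp flip: plus)
    qed
  qed
  then show ?thesis
    by unfold_locales
qed

text \<open>
  If \<open>C = A + T\<close>, then \<open>T\<close> need not belong to the monoid, but \<open>T + T\<close> does. So the inclusion
  becomes a divisibility in the monoid after doubling, and doubling can be undone in the target.
\<close>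

lemma subset_mono:
  assumes "A \<in> BG" "C \<in> BG" "A \<subseteq># C"
  shows "\<phi> A \<subseteq># \<phi> C"
proof -
  obtain T where C: "C = A + T"
    using assms(3) by (auto simp: subset_mset.le_iff_add)
  then have T: "T + T \<in> BG"
    using assms(2) by (intro G.pm_zero_sum_monoid_double) (auto simp: carrier_pm_zero_sum_monoid)
  have "C + C = (A + A) + (T + T)"
    by (simp add: C ac_simps)
  then have "\<phi> (C + C) = \<phi> (A + A) + \<phi> (T + T)"
    using assms T G.pm_zero_sum_monoid_plus[of A A] by (simp only: plus)
  then have "\<phi> C + \<phi> C = \<phi> A + \<phi> A + \<phi> (T + T)"
    using assms by simp
  then have "\<phi> A + \<phi> A \<subseteq># \<phi> C + \<phi> C"
    by (metis mset_subset_eq_add_left)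
  then show ?thesis
    by (rule double_subset_mset_cancel)
qed

lemma subset_iff:
  assumes "A \<in> BG" "C \<in> BG"
  shows "\<phi> A \<subseteq># \<phi> C \<longleftrightarrow> A \<subseteq># C"
proof
  assume "\<phi> A \<subseteq># \<phi> C"
  then have "inv_into BG \<phi> (\<phi> A) \<subseteq># inv_into BG \<phi> (\<phi> C)"
    using assms closed pm_iso.subset_mono[OF inverse] by blast
  moreover have "inv_into BG \<phi> (\<phi> S) = S" if "S \<in> BG" for S
    using that iso by (auto simp: iso_def bij_betw_def)
  ultimately show "A \<subseteq># C"
    using assms by simp
qed (use assms subset_mono in blast)

text \<open>
  If \<open>h\<close> occurs in the image of the square of \<open>g\<close>, then the square of \<open>h\<close> is contained in the
  image of the fourth power of \<open>g\<close>, so its preimage is a power of \<open>g\<close>. Any two powers of \<open>g\<close> have a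
  common power, whereas powers of distinct elements \<open>h\<close> and \<open>h'\<close> have none except the empty one.
\<close>

lemma square_singleton_support:
  assumes g: "g \<in> carrier G" and h: "h \<in># \<phi> {#g, g#}" "h' \<in># \<phi> {#g, g#}"
  shows "h = h'"
proof -
  have sq: "{#g, g#} \<in> BG"
    using g by (rule G.pm_zero_sum_monoid_square)
  have preimage: "\<exists>j>0. replicate_mset j g \<in> BG \<and> \<phi> (replicate_mset j g) = {#x, x#}"
    if x: "x \<in># \<phi> {#g, g#}" for x
  proof -
    have "x \<in> carrier H"
      using x closed[OF sq] by (auto simp: carrier_pm_zero_sum_monoid)
    then obtain D where D: "D \<in> BG" "\<phi> D = {#x, x#}"
      using surj[OF H.pm_zero_sum_monoid_square] by blast
    have "{#x, x#} \<subseteq># \<phi> {#g, g#} + \<phi> {#g, g#}"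
      using mset_subset_eq_mono_add[of "{#x#}" "\<phi> {#g, g#}" "{#x#}" "\<phi> {#g, g#}"] x by simp
    then have "\<phi> D \<subseteq># \<phi> ({#g, g#} + {#g, g#})"
      using D sq by (simp only: plus)
    then have "D \<subseteq># {#g, g#} + {#g, g#}"
      using D(1) sq G.pm_zero_sum_monoid_plus subset_iff by blast
    then have "D \<subseteq># replicate_mset 4 g"
      by (simp add: numeral_eq_Suc)
    then obtain j where j: "D = replicate_mset j g"
      by (elim msubseteq_replicate_msetE)
    moreover have "j \<noteq> 0"
      using D j by (intro notI) simp
    ultimately show ?thesis
      using D by auto
  qed
  obtain j where j: "j > 0" "replicate_mset j g \<in> BG" "\<phi> (replicate_mset j g) = {#h, h#}"
    using preimage[OF h(1)] by blast
  obtain j' where j': "j' > 0" "replicate_mset j' g \<in> BG" "\<phi> (replicate_mset j' g) = {#h', h'#}"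
    using preimage[OF h(2)] by blast
  have "repeat_mset j' (replicate_mset j g) = repeat_mset j (replicate_mset j' g)"
    by (simp add: repeat_mset_replicate mult.commute)
  then have "repeat_mset j' {#h, h#} = repeat_mset j {#h', h'#}"
    using repeat[OF j(2), of j'] repeat[OF j'(2), of j] j(3) j'(3) by simp
  then have "set_mset (repeat_mset j' {#h, h#}) = set_mset (repeat_mset j {#h', h'#})"
    by simp
  then show ?thesis
    using j(1) j'(1) by (simp split: if_splits)
qed

text \<open>
  For \<open>g\<close> in the group, the image of its square repeats a single element \<open>base g\<close>, by the preceding
  lemma; so any choice of a term gives the same element.
\<close>

definition base :: "'a \<Rightarrow> 'b" where
  "base g = (SOME h. h \<in># \<phi> {#g, g#})"

definition exponent :: "'a \<Rightarrow> nat" where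
  "exponent g = size (\<phi> {#g, g#})"

lemma square:
  assumes "g \<in> carrier G"
  shows "\<phi> {#g, g#} = replicate_mset (exponent g) (base g)" "exponent g > 0" "base g \<in> carrier H"
proof -
  have sq: "{#g, g#} \<in> BG"
    using assms by (rule G.pm_zero_sum_monoid_square)
  then have nonempty: "\<phi> {#g, g#} \<noteq> {#}"
    using eq_empty_iff by simp
  then show "exponent g > 0"
    by (simp add: exponent_def nonempty_has_size)
  from nonempty have base: "base g \<in># \<phi> {#g, g#}"
    unfolding base_def by (metis multiset_nonemptyE someI_ex)
  then have "set_mset (\<phi> {#g, g#}) \<subseteq> {base g}"
    using square_singleton_support[OF assms] by blast
  then show "\<phi> {#g, g#} = replicate_mset (exponent g) (base g)"
    unfolding exponent_def by (metis set_mset_subset_singletonD)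
  show "base g \<in> carrier H"
    using base closed[OF sq] by (auto simp: carrier_pm_zero_sum_monoid)
qed

lemma inj_on_base: "inj_on base (carrier G)"
proof (rule inj_onI)
  fix g g' assume g: "g \<in> carrier G" and g': "g' \<in> carrier G" and "base g = base g'"
  then have "repeat_mset (exponent g') (\<phi> {#g, g#}) = repeat_mset (exponent g) (\<phi> {#g', g'#})"
    using g g' by (simp add: square repeat_mset_replicate mult.commute)
  then have "\<phi> (repeat_mset (exponent g') {#g, g#}) = \<phi> (repeat_mset (exponent g) {#g', g'#})"
    using g g' by (simp only: repeat G.pm_zero_sum_monoid_square)
  then have "repeat_mset (exponent g') {#g, g#} = repeat_mset (exponent g) {#g', g'#}"
    by (rule inj[rotated 2]) (simp_all only: g g' G.pm_zero_sum_monoid_square G.pm_zero_sum_monoid_repeat)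
  then have "set_mset (repeat_mset (exponent g') {#g, g#}) = set_mset (repeat_mset (exponent g) {#g', g'#})"
    by simp
  then show "g = g'"
    using square(2)[OF g] square(2)[OF g'] by (simp split: if_splits)
qed

text \<open>
  The inverse isomorphism maps the square of \<open>h\<close> to some power \<open>j\<close> of some \<open>g\<close>. Applying \<open>\<phi>\<close> to
  the square of this power gives the fourth power of \<open>h\<close> on the one hand and the power
  \<open>j * exponent g\<close> of \<open>base g\<close> on the other hand.
\<close>

lemma square_preimage:
  assumes "h \<in> carrier H"
  obtains g j where "g \<in> carrier G" "base g = h" "j * exponent g = 4"
    "replicate_mset j g \<in> BG" "\<phi> (replicate_mset j g) = {#h, h#}"
proof -
  interpret inv: pm_iso H G "inv_into BG \<phi>"
    by (rule inverse)
  define g j where "g = inv.base h" and "j = inv.exponent h"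
  have sq: "{#h, h#} \<in> BH"
    using assms by (rule H.pm_zero_sum_monoid_square)
  have D: "inv_into BG \<phi> {#h, h#} = replicate_mset j g" and g: "g \<in> carrier G" and j: "j > 0"
    using inv.square[OF assms] by (auto simp: g_def j_def)
  have jg: "replicate_mset j g \<in> BG"
    using inv.closed[OF sq] by (simp add: D)
  have phi: "\<phi> (replicate_mset j g) = {#h, h#}"
    unfolding D[symmetric] using sq by (simp add: f_inv_into_f image_eq)
  have "replicate_mset j g + replicate_mset j g = repeat_mset j {#g, g#}"
    by (induction j) auto
  then have "\<phi> (replicate_mset j g) + \<phi> (replicate_mset j g) = repeat_mset j (\<phi> {#g, g#})"
    using jg by (metis G.pm_zero_sum_monoid_square g plus repeat)
  then have eq: "replicate_mset 4 h = replicate_mset (j * exponent g) (base g)"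
    unfolding phi using square[OF g] by (simp add: numeral_eq_Suc repeat_mset_replicate)
  then have "j * exponent g = 4"
    by (metis size_replicate_mset)
  moreover have "base g = h"
    using eq \<open>j * exponent g = 4\<close> replicate_mset_eq_iff[of 4 h "j * exponent g" "base g"] by (metis zero_neq_numeral)
  ultimately show ?thesis
    using that g jg phi by blast
qed

lemma bij_betw_base: "bij_betw base (carrier G) (carrier H)"
proof -
  have "base ` carrier G = carrier H"
  proof (intro subset_antisym subsetI)
    show "h \<in> base ` carrier G" if "h \<in> carrier H" for h
      by (rule square_preimage[OF that]) (rule image_eqI, rule sym)
  qed (auto intro: square(3))
  then show ?thesis
    using inj_on_base by (simp add: bij_betw_def)
qed

text \<open>
  Since the exponents of \<open>\<phi>\<close> and of its inverse multiply to 4, an exponent other than 2 is 1 or 4. Then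
  one of the two monoids contains a one-term sequence, whose term is the neutral element.
\<close>

lemma exponent_cases:
  assumes g: "g \<in> carrier G"
  obtains "exponent g = 2" | "exponent g = 1" "base g = \<one>\<^bsub>H\<^esub>" | "g = \<one>\<^bsub>G\<^esub>" "\<phi> {#\<one>\<^bsub>G\<^esub>#} = {#base g, base g#}"
proof -
  obtain g' j where g': "g' \<in> carrier G" "base g' = base g" and "j * exponent g' = 4"
    "replicate_mset j g' \<in> BG" "\<phi> (replicate_mset j g') = {#base g, base g#}"
    by (rule square_preimage[OF square(3)[OF g]])
  moreover have "g' = g"
    using inj_onD[OF inj_on_base g'(2) g'(1) g] .
  ultimately have four: "j * exponent g = 4"
    and jg: "replicate_mset j g \<in> BG" and phi: "\<phi> (replicate_mset j g) = {#base g, base g#}"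
    by simp_all
  then have "exponent g dvd 4"
    by (metis dvd_triv_right)
  then have "exponent g \<le> 4"
    by (rule dvd_imp_le) simp
  moreover have "exponent g \<noteq> 3"
  proof
    assume "exponent g = 3"
    then have "j * 3 = 4"
      using four by simp
    then show False by presburger
  qed
  ultimately consider "exponent g = 1" | "exponent g = 2" | "exponent g = 4"
    using square(2)[OF g] by linarith
  then show thesis
  proof cases
    case 1
    then have "{#base g#} \<in> BH"
      using square(1)[OF g] closed[OF G.pm_zero_sum_monoid_square[OF g]] by simp
    then show ?thesis
      using that(2) 1 by (simp add: H.pm_zero_sum_monoid_single_iff)
  next
    case 2
    then show ?thesis by (rule that(1))
  next
    case 3
    then have "j = 1"
      using four by simp
    then have "{#g#} \<in> BG" "\<phi> {#g#} = {#base g, base g#}"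
      using jg phi by auto
    then show ?thesis
      using that(3) by (simp add: G.pm_zero_sum_monoid_single_iff)
  qed
qed

text \<open>
  A member of the monoid over \<open>G\<close> contains the sequence \<open>\<one>\<close> as soon as its square does. Transported
  to \<open>H\<close>, this says that every member of the monoid over \<open>H\<close> in which \<open>h\<close> occurs contains it at
  least twice. A third element \<open>x\<close> of \<open>H\<close> would violate this in the sequence with terms
  \<open>h\<close>, \<open>x\<close>, \<open>h \<otimes> x\<close>. If \<open>h\<close> were neutral, the double of the preimage of the one-term sequence
  \<open>h\<close> would be the one-term sequence \<open>\<one>\<close>, against parity of the length.
\<close>

lemma order_two:
  assumes h: "h \<in> carrier H" and eq: "\<phi> {#\<one>\<^bsub>G\<^esub>#} = {#h, h#}"
  shows "h \<noteq> \<one>\<^bsub>H\<^esub>" "carrier H = {\<one>\<^bsub>H\<^esub>, h}"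
proof -
  have one: "{#\<one>\<^bsub>G\<^esub>#} \<in> BG"
    by (simp add: G.pm_zero_sum_monoid_single_iff)
  show h1: "h \<noteq> \<one>\<^bsub>H\<^esub>"
  proof
    assume "h = \<one>\<^bsub>H\<^esub>"
    then have "{#h#} \<in> BH"
      by (simp add: H.pm_zero_sum_monoid_single_iff)
    then obtain D where D: "D \<in> BG" "\<phi> D = {#h#}"
      using surj by blast
    then have "\<phi> (D + D) = \<phi> {#\<one>\<^bsub>G\<^esub>#}"
      by (simp add: eq)
    then have "D + D = {#\<one>\<^bsub>G\<^esub>#}"
      by (rule inj[rotated 2]) (simp_all only: D one G.pm_zero_sum_monoid_plus)
    then have "size (D + D) = 1"
      by simp
    then show False
      by (simp only: size_union) presburger
  qed
  have twice: "{#h, h#} \<subseteq># C" if C: "C \<in> BH" "h \<in># C" for C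
  proof -
    obtain D where D: "D \<in> BG" "\<phi> D = C"
      using surj C(1) by blast
    have "{#h, h#} \<subseteq># C + C"
      using mset_subset_eq_mono_add[of "{#h#}" C "{#h#}" C] C(2) by simp
    then have "\<phi> {#\<one>\<^bsub>G\<^esub>#} \<subseteq># \<phi> (D + D)"
      using D by (simp add: eq)
    then have "{#\<one>\<^bsub>G\<^esub>#} \<subseteq># D + D"
      using D(1) one G.pm_zero_sum_monoid_plus subset_iff by blast
    then have "{#\<one>\<^bsub>G\<^esub>#} \<subseteq># D"
      by simp
    then show ?thesis
      using subset_mono[OF one D(1)] D(2) eq by simp
  qed
  have "x = h" if x: "x \<in> carrier H" "x \<noteq> \<one>\<^bsub>H\<^esub>" for x
  proof (rule ccontr)
    assume "x \<noteq> h"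
    have hx: "h \<otimes>\<^bsub>H\<^esub> x \<in> carrier H" "h \<otimes>\<^bsub>H\<^esub> x \<noteq> h"
      using h x by auto
    have "h = inv\<^bsub>H\<^esub> x \<otimes>\<^bsub>H\<^esub> (h \<otimes>\<^bsub>H\<^esub> x)"
      using h x by (simp add: H.m_lcomm H.r_inv)
    then have "{#h, x, h \<otimes>\<^bsub>H\<^esub> x#} \<in> BH"
      using h x hx by (simp add: carrier_pm_zero_sum_monoid H.pm_zero_sum_triple_iff)
    then have "{#h, h#} \<subseteq># {#h, x, h \<otimes>\<^bsub>H\<^esub> x#}"
      using twice by simp
    then show False
      using \<open>x \<noteq> h\<close> hx(2) by auto
  qed
  then show "carrier H = {\<one>\<^bsub>H\<^esub>, h}"
    using h by auto
qed

text \<open>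
  With the neutral element in place, all exponents are 2. Then \<open>\<phi>\<close> and the termwise application of
  \<open>base\<close> agree on \<open>S + S\<close> for every sequence \<open>S\<close>, and doubling is injective on multisets.
\<close>

lemma induced_by_bijection:
  assumes one: "\<phi> {#\<one>\<^bsub>G\<^esub>#} = {#\<one>\<^bsub>H\<^esub>#}" and A: "A \<in> BG"
  shows "\<phi> A = image_mset base A"
proof -
  have exponent: "exponent g = 2" if g: "g \<in> carrier G" for g
    using g
  proof (cases rule: exponent_cases)
    case 2
    then have "\<phi> {#g, g#} = \<phi> {#\<one>\<^bsub>G\<^esub>#}"
      using square(1)[OF g] one by simp
    then have "{#g, g#} = {#\<one>\<^bsub>G\<^esub>#}"
      by (rule inj[rotated 2]) (simp_all add: g G.pm_zero_sum_monoid_square G.pm_zero_sum_monoid_single_iff)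
    then show ?thesis by simp
  next
    case 3
    then show ?thesis using one by simp
  qed
  have double: "\<phi> (S + S) = image_mset base S + image_mset base S" if "set_mset S \<subseteq> carrier G" for S
    using that
  proof (induction S)
    case (add g S)
    have "\<phi> (add_mset g S + add_mset g S) = \<phi> ({#g, g#} + (S + S))"
      by simp
    also have "\<dots> = \<phi> {#g, g#} + \<phi> (S + S)"
      using add.prems by (intro plus G.pm_zero_sum_monoid_square G.pm_zero_sum_monoid_double) auto
    finally show ?case
      using add by (simp add: square exponent numeral_eq_Suc)
  qed simp
  have "\<phi> A + \<phi> A = image_mset base A + image_mset base A"
    using double[of A] A by (simp add: carrier_pm_zero_sum_monoid flip: plus)
  then show ?thesis
    by (rule double_mset_cancel)
qed

text \<open>
  By \<open>order_two\<close>, it suffices to exclude the first two of the \<open>exponent_cases\<close> for the neutral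
  element. If the exponent is 2, the image of the one-term sequence \<open>\<one>\<close> has a single term, and this
  term is neutral. The exponent cannot be 1, because it is the length of a doubled sequence.
\<close>

lemma identity_or_order_two:
  assumes "\<phi> {#\<one>\<^bsub>G\<^esub>#} \<noteq> {#\<one>\<^bsub>H\<^esub>#}"
  shows "\<exists>h. h \<noteq> \<one>\<^bsub>H\<^esub> \<and> carrier H = {\<one>\<^bsub>H\<^esub>, h}"
proof -
  have one: "{#\<one>\<^bsub>G\<^esub>#} \<in> BG"
    by (simp add: G.pm_zero_sum_monoid_single_iff)
  have double: "\<phi> {#\<one>\<^bsub>G\<^esub>#} + \<phi> {#\<one>\<^bsub>G\<^esub>#} = \<phi> {#\<one>\<^bsub>G\<^esub>, \<one>\<^bsub>G\<^esub>#}"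
    using one by (simp flip: plus)
  have "\<phi> {#\<one>\<^bsub>G\<^esub>#} = {#base \<one>\<^bsub>G\<^esub>, base \<one>\<^bsub>G\<^esub>#}"
    using G.one_closed
  proof (cases rule: exponent_cases)
    case 1
    then have "\<phi> {#\<one>\<^bsub>G\<^esub>#} + \<phi> {#\<one>\<^bsub>G\<^esub>#} = {#base \<one>\<^bsub>G\<^esub>#} + {#base \<one>\<^bsub>G\<^esub>#}"
      by (simp add: double square numeral_eq_Suc)
    then have "\<phi> {#\<one>\<^bsub>G\<^esub>#} = {#base \<one>\<^bsub>G\<^esub>#}"
      by (rule double_mset_cancel)
    moreover from this have "base \<one>\<^bsub>G\<^esub> = \<one>\<^bsub>H\<^esub>"
      using closed[OF one] by (simp add: H.pm_zero_sum_monoid_single_iff)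
    ultimately show ?thesis
      using assms by simp
  next
    case 2
    then have "size (\<phi> {#\<one>\<^bsub>G\<^esub>#} + \<phi> {#\<one>\<^bsub>G\<^esub>#}) = 1"
      by (simp add: double exponent_def)
    then have False
      by (simp only: size_union) presburger
    then show ?thesis ..
  qed
  then show ?thesis
    using order_two square(3) G.one_closed by blast
qed

end

lemma order_two_groups_iso:
  assumes "group G" "group H" and bij: "bij_betw f (carrier G) (carrier H)"
    and H: "h \<noteq> \<one>\<^bsub>H\<^esub>" "carrier H = {\<one>\<^bsub>H\<^esub>, h}"
  shows "G \<cong> H"
proof -
  interpret G: group G by fact
  interpret H: group H by fact
  have "card (carrier G) = 2"
    using bij_betw_same_card[OF bij] H by simp
  then obtain x y where "carrier G = {x, y}" "x \<noteq> y"
    by (auto simp: card_2_iff)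
  moreover define g where "g = (if x = \<one>\<^bsub>G\<^esub> then y else x)"
  ultimately have g: "g \<noteq> \<one>\<^bsub>G\<^esub>" "carrier G = {\<one>\<^bsub>G\<^esub>, g}"
    using G.one_closed by (auto simp: insert_commute)
  have gg: "g \<otimes>\<^bsub>G\<^esub> g = \<one>\<^bsub>G\<^esub>" and hh: "h \<otimes>\<^bsub>H\<^esub> h = \<one>\<^bsub>H\<^esub>"
    using G.m_closed[of g g] H.m_closed[of h h] g H by auto
  define k where "k x = (if x = \<one>\<^bsub>G\<^esub> then \<one>\<^bsub>H\<^esub> else h)" for x
  have "k \<in> iso G H"
  proof (rule isoI)
    show "k \<in> hom G H"
      by (rule homI) (use g H gg hh in \<open>auto simp: k_def\<close>)
    show "bij_betw k (carrier G) (carrier H)"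
      unfolding bij_betw_def inj_on_def g(2) H(2) using g(1) H(1) by (auto simp: k_def)
  qed
  then show ?thesis
    by (rule is_isoI)
qed

section \<open>Group isomorphisms induce monoid isomorphisms\<close>

lemma pm_zero_sum_hom:
  assumes "comm_group G" "comm_group H" and hom: "\<psi> \<in> hom G H"
    and S: "set_mset S \<subseteq> carrier G" and "pm_zero_sum G S"
  shows "pm_zero_sum H (image_mset \<psi> S)"
proof -
  interpret G: comm_group G by fact
  interpret H: comm_group H by fact
  interpret group_hom G H \<psi>
    using hom by unfold_locales
  have "\<psi> w \<in> H.signed_products (image_mset \<psi> S)" if "w \<in> G.signed_products S" for w
    using S that
  proof (induction S arbitrary: w)
    case (add g S)
    then have w: "w \<in> carrier G" "g \<in> carrier G"
      and "g \<otimes>\<^bsub>G\<^esub> w \<in> G.signed_products S \<or> inv\<^bsub>G\<^esub> g \<otimes>\<^bsub>G\<^esub> w \<in> G.signed_products S"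
      by (auto simp: G.signed_step_def)
    then have "\<psi> (g \<otimes>\<^bsub>G\<^esub> w) \<in> H.signed_products (image_mset \<psi> S) \<or>
        \<psi> (inv\<^bsub>G\<^esub> g \<otimes>\<^bsub>G\<^esub> w) \<in> H.signed_products (image_mset \<psi> S)"
      using add.IH add.prems(1) unfolding set_mset_add_mset_insert insert_subset by blast
    with w show ?case
      by (auto simp: H.signed_step_def)
  qed auto
  from this[of "\<one>\<^bsub>G\<^esub>"] have "\<one>\<^bsub>H\<^esub> \<in> H.signed_products (image_mset \<psi> S)"
    using assms(5) S by (simp add: G.pm_zero_sum_iff_signed_products)
  moreover have "set_mset (image_mset \<psi> S) \<subseteq> carrier H"
    using S by auto
  ultimately show ?thesis
    by (simp only: H.pm_zero_sum_iff_signed_products)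
qed

lemma pm_zero_sum_monoid_iso:
  assumes "comm_group G" "comm_group H" "G \<cong> H"
  shows "pm_zero_sum_monoid G \<cong> pm_zero_sum_monoid H"
proof -
  interpret G: comm_group G by fact
  interpret H: comm_group H by fact
  obtain \<psi> where \<psi>: "\<psi> \<in> iso G H"
    using assms(3) by (auto simp: is_iso_def)
  define \<chi> where "\<chi> = inv_into (carrier G) \<psi>"
  have \<chi>: "\<chi> \<in> iso H G"
    unfolding \<chi>_def using \<psi> by (rule G.iso_set_sym)
  have \<chi>\<psi>: "\<chi> (\<psi> g) = g" if "g \<in> carrier G" for g
    using \<psi> that by (auto simp: \<chi>_def iso_def bij_betw_def)
  have \<psi>\<chi>: "\<psi> (\<chi> h) = h" if "h \<in> carrier H" for h
    using \<psi> that by (auto simp: \<chi>_def iso_def bij_betw_def f_inv_into_f)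
  have cancel: "image_mset \<chi> (image_mset \<psi> S) = S" if "set_mset S \<subseteq> carrier G" for S
    using that by (induction S) (auto simp: \<chi>\<psi>)
  have cancel': "image_mset \<psi> (image_mset \<chi> S) = S" if "set_mset S \<subseteq> carrier H" for S
    using that by (induction S) (auto simp: \<psi>\<chi>)
  have closed: "image_mset \<psi> S \<in> carrier (pm_zero_sum_monoid H)"
    if "S \<in> carrier (pm_zero_sum_monoid G)" for S
    using that \<psi> pm_zero_sum_hom[OF assms(1,2), of \<psi> S]
    by (auto simp: carrier_pm_zero_sum_monoid iso_def hom_def)
  have closed': "image_mset \<chi> S \<in> carrier (pm_zero_sum_monoid G)"
    if "S \<in> carrier (pm_zero_sum_monoid H)" for S
    using that \<chi> pm_zero_sum_hom[OF assms(2,1), of \<chi> S]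
    by (auto simp: carrier_pm_zero_sum_monoid iso_def hom_def)
  have "image_mset \<psi> \<in> iso (pm_zero_sum_monoid G) (pm_zero_sum_monoid H)"
  proof (rule isoI)
    show "image_mset \<psi> \<in> hom (pm_zero_sum_monoid G) (pm_zero_sum_monoid H)"
      by (rule homI) (simp_all add: closed)
    show "bij_betw (image_mset \<psi>) (carrier (pm_zero_sum_monoid G)) (carrier (pm_zero_sum_monoid H))"
    proof (rule bij_betw_byWitness[where f' = "image_mset \<chi>"])
      show "\<forall>S\<in>carrier (pm_zero_sum_monoid G). image_mset \<chi> (image_mset \<psi> S) = S"
        using cancel by (auto simp: carrier_pm_zero_sum_monoid)
      show "\<forall>S\<in>carrier (pm_zero_sum_monoid H). image_mset \<psi> (image_mset \<chi> S) = S"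
        using cancel' by (auto simp: carrier_pm_zero_sum_monoid)
    qed (use closed closed' in blast)+
  qed
  then show ?thesis
    by (rule is_isoI)
qed

section \<open>Bijections that preserve signed zero sums\<close>

text \<open>
  Such a bijection remembers the group structure only up to signs, and in general it is not a
  homomorphism: the signs can be chosen independently at each pair of an element and its inverse.
\<close>

locale zero_sum_bijection = G: comm_group G + H: comm_group H
  for G :: "('a, 'x) monoid_scheme" and H :: "('b, 'y) monoid_scheme" +
  fixes f :: "'a \<Rightarrow> 'b"
  assumes bij: "bij_betw f (carrier G) (carrier H)"
    and zero_sum_iff: "set_mset S \<subseteq> carrier G \<Longrightarrow> pm_zero_sum H (image_mset f S) \<longleftrightarrow> pm_zero_sum G S"
begin

lemma closed [simp]: "x \<in> carrier G \<Longrightarrow> f x \<in> carrier H"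
  using bij by (auto simp: bij_betw_def)

lemma surj: "u \<in> carrier H \<Longrightarrow> \<exists>z\<in>carrier G. f z = u"
  using bij by (metis bij_betw_def imageE)

lemma eq_iff: "x \<in> carrier G \<Longrightarrow> y \<in> carrier G \<Longrightarrow> f x = f y \<longleftrightarrow> x = y"
  using bij by (auto simp: bij_betw_def inj_on_def)

lemma one [simp]: "f \<one>\<^bsub>G\<^esub> = \<one>\<^bsub>H\<^esub>"
  using zero_sum_iff[of "{#\<one>\<^bsub>G\<^esub>#}"] by (simp add: G.pm_zero_sum_single_iff H.pm_zero_sum_single_iff)

lemma same_up_to_sign_iff:
  assumes "x \<in> carrier G" "y \<in> carrier G"
  shows "f y \<in> {f x, inv\<^bsub>H\<^esub> f x} \<longleftrightarrow> y \<in> {x, inv\<^bsub>G\<^esub> x}"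
  using zero_sum_iff[of "{#x, y#}"] assms by (simp add: G.pm_zero_sum_pair_iff H.pm_zero_sum_pair_iff)

lemma inv_cases: "x \<in> carrier G \<Longrightarrow> f (inv\<^bsub>G\<^esub> x) \<in> {f x, inv\<^bsub>H\<^esub> f x}"
  by (subst same_up_to_sign_iff) auto

text \<open>
  By \<open>same_up_to_sign_iff\<close>, the preimage of \<open>inv (f x)\<close> lies in \<open>{x, inv x}\<close>, which is \<open>{x}\<close> here.
\<close>

lemma self_inverse:
  assumes x: "x \<in> carrier G" and "inv\<^bsub>G\<^esub> x = x"
  shows "inv\<^bsub>H\<^esub> f x = f x"
proof -
  obtain z where z: "z \<in> carrier G" "f z = inv\<^bsub>H\<^esub> f x"
    using surj x by (metis H.inv_closed closed)
  then have "z \<in> {x, inv\<^bsub>G\<^esub> x}"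
    using same_up_to_sign_iff[OF x z(1)] by simp
  with assms z show ?thesis by simp
qed

lemma triple_iff:
  assumes "x \<in> carrier G" "y \<in> carrier G" "z \<in> carrier G"
  shows "f z \<in> signed_pair H (f x) (f y) \<longleftrightarrow>
    z \<in> signed_pair G x y"
  using zero_sum_iff[of "{#z, x, y#}"] assms by (simp add: G.pm_zero_sum_triple_iff H.pm_zero_sum_triple_iff)

lemma mult_cases:
  assumes "x \<in> carrier G" "y \<in> carrier G"
  shows "f (x \<otimes>\<^bsub>G\<^esub> y) \<in> signed_pair H (f x) (f y)"
  using assms by (subst triple_iff) auto

lemma mult_preimage:
  assumes "x \<in> carrier G" "y \<in> carrier G" "v \<in> {f y, inv\<^bsub>H\<^esub> f y}"
  obtains z where "f z = f x \<otimes>\<^bsub>H\<^esub> v"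
    "z \<in> signed_pair G x y"
proof -
  have "f x \<otimes>\<^bsub>H\<^esub> v \<in> carrier H"
    using assms by auto
  then obtain z where "z \<in> carrier G" "f z = f x \<otimes>\<^bsub>H\<^esub> v"
    using surj by blast
  moreover from this have "z \<in> signed_pair G x y"
    using assms by (subst triple_iff[symmetric]) auto
  ultimately show ?thesis using that by blast
qed

text \<open>
  Multiplying \<open>x\<^sup>m\<^sup>+\<^sup>1\<close> by \<open>x\<close> leaves two possibilities for the image of \<open>x\<^sup>m\<^sup>+\<^sup>2\<close>, up to inversion: the
  power of \<open>f x\<close> with exponent \<open>m + 2\<close> or the one with exponent \<open>m\<close>. In the second case the induction hypothesis and
  \<open>same_up_to_sign_iff\<close> show that \<open>x\<^sup>m\<^sup>+\<^sup>2\<close> is \<open>x\<^sup>m\<close> or its inverse, so \<open>x\<close> or \<open>x\<^sup>m\<^sup>+\<^sup>1\<close> is its own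
  inverse. This property passes to the image by \<open>self_inverse\<close> and makes the two powers of
  \<open>f x\<close> equal up to inversion.
\<close>

lemma nat_pow_cases:
  fixes n :: nat
  assumes x: "x \<in> carrier G"
  shows "f (x [^]\<^bsub>G\<^esub> n) \<in> {f x [^]\<^bsub>H\<^esub> n, inv\<^bsub>H\<^esub> (f x [^]\<^bsub>H\<^esub> n)}"
proof (induction n rule: induct_nat_012)
  case (ge2 m)
  define y where "y = f x"
  define p where "p = y [^]\<^bsub>H\<^esub> Suc m"
  have y: "y \<in> carrier H" and p: "p \<in> carrier H"
    using x by (simp_all add: y_def p_def)
  have p_y: "p \<otimes>\<^bsub>H\<^esub> y = y [^]\<^bsub>H\<^esub> Suc (Suc m)"
    by (simp add: p_def)
  have p_inv_y: "p \<otimes>\<^bsub>H\<^esub> inv\<^bsub>H\<^esub> y = y [^]\<^bsub>H\<^esub> m"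
    using y by (simp add: p_def H.m_assoc)
  have "f (x [^]\<^bsub>G\<^esub> Suc (Suc m)) \<in> signed_pair H p y"
    using mult_cases[of "x [^]\<^bsub>G\<^esub> Suc m" x] ge2(2) x p by (auto simp: y_def p_def simp del: nat_pow_Suc)
  moreover have "inv\<^bsub>H\<^esub> p \<otimes>\<^bsub>H\<^esub> y = inv\<^bsub>H\<^esub> (p \<otimes>\<^bsub>H\<^esub> inv\<^bsub>H\<^esub> y)" "inv\<^bsub>H\<^esub> p \<otimes>\<^bsub>H\<^esub> inv\<^bsub>H\<^esub> y = inv\<^bsub>H\<^esub> (p \<otimes>\<^bsub>H\<^esub> y)"
    using y p by (simp_all add: H.inv_mult)
  ultimately consider "f (x [^]\<^bsub>G\<^esub> Suc (Suc m)) \<in> {y [^]\<^bsub>H\<^esub> Suc (Suc m), inv\<^bsub>H\<^esub> (y [^]\<^bsub>H\<^esub> Suc (Suc m))}"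
    | "f (x [^]\<^bsub>G\<^esub> Suc (Suc m)) \<in> {y [^]\<^bsub>H\<^esub> m, inv\<^bsub>H\<^esub> (y [^]\<^bsub>H\<^esub> m)}"
    unfolding p_y p_inv_y by auto
  then show ?case
  proof cases
    case 1
    then show ?thesis by (simp add: y_def)
  next
    case 2
    have "f (x [^]\<^bsub>G\<^esub> Suc (Suc m)) \<in> {f (x [^]\<^bsub>G\<^esub> m), inv\<^bsub>H\<^esub> f (x [^]\<^bsub>G\<^esub> m)}"
      using 2 ge2(1) y by (auto simp: y_def)
    then have "x [^]\<^bsub>G\<^esub> Suc (Suc m) \<in> {x [^]\<^bsub>G\<^esub> m, inv\<^bsub>G\<^esub> (x [^]\<^bsub>G\<^esub> m)}"
      using x by (subst (asm) same_up_to_sign_iff) auto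
    then consider "x [^]\<^bsub>G\<^esub> Suc (Suc m) = x [^]\<^bsub>G\<^esub> m" | "x [^]\<^bsub>G\<^esub> Suc (Suc m) = inv\<^bsub>G\<^esub> (x [^]\<^bsub>G\<^esub> m)"
      by blast
    then have "y [^]\<^bsub>H\<^esub> Suc (Suc m) \<in> {y [^]\<^bsub>H\<^esub> m, inv\<^bsub>H\<^esub> (y [^]\<^bsub>H\<^esub> m)}"
    proof cases
      case 1
      then have "x [^]\<^bsub>G\<^esub> m \<otimes>\<^bsub>G\<^esub> (x \<otimes>\<^bsub>G\<^esub> x) = x [^]\<^bsub>G\<^esub> m"
        using x by (simp add: G.m_assoc)
      then have "x \<otimes>\<^bsub>G\<^esub> x = \<one>\<^bsub>G\<^esub>"
        using x by simp
      then have "inv\<^bsub>H\<^esub> y = y"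
        unfolding y_def using x by (intro self_inverse) (auto intro: G.inv_equality)
      then have "y \<otimes>\<^bsub>H\<^esub> y = \<one>\<^bsub>H\<^esub>"
        using y H.l_inv[of y] by simp
      then have "y [^]\<^bsub>H\<^esub> Suc (Suc m) = y [^]\<^bsub>H\<^esub> m"
        using y by (simp add: H.m_assoc)
      then show ?thesis by simp
    next
      case 2
      let ?a = "x [^]\<^bsub>G\<^esub> Suc m"
      have "?a \<otimes>\<^bsub>G\<^esub> ?a = x [^]\<^bsub>G\<^esub> Suc (Suc m) \<otimes>\<^bsub>G\<^esub> x [^]\<^bsub>G\<^esub> m"
        using x by (simp add: G.m_ac)
      also have "\<dots> = \<one>\<^bsub>G\<^esub>"
        unfolding 2 using x by simp
      finally have "?a \<otimes>\<^bsub>G\<^esub> ?a = \<one>\<^bsub>G\<^esub>" .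
      then have "inv\<^bsub>H\<^esub> f ?a = f ?a"
        using x by (intro self_inverse G.inv_equality) (auto simp del: nat_pow_Suc)
      then have "inv\<^bsub>H\<^esub> p = p"
        using ge2(2) p by (auto simp: p_def y_def simp del: nat_pow_Suc)
      then have "p \<otimes>\<^bsub>H\<^esub> p = \<one>\<^bsub>H\<^esub>"
        using p H.l_inv[of p] by simp
      then have "y [^]\<^bsub>H\<^esub> Suc (Suc m) \<otimes>\<^bsub>H\<^esub> y [^]\<^bsub>H\<^esub> m = \<one>\<^bsub>H\<^esub>"
        using y by (simp add: p_def H.m_ac)
      then have "inv\<^bsub>H\<^esub> (y [^]\<^bsub>H\<^esub> m) = y [^]\<^bsub>H\<^esub> Suc (Suc m)"
        using y by (intro H.inv_equality) (auto simp del: nat_pow_Suc)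
      then show ?thesis by simp
    qed
    then show ?thesis
      using \<open>f (x [^]\<^bsub>G\<^esub> Suc (Suc m)) \<in> {y [^]\<^bsub>H\<^esub> m, inv\<^bsub>H\<^esub> (y [^]\<^bsub>H\<^esub> m)}\<close> y
      by (auto simp: y_def simp del: nat_pow_Suc)
  qed
qed (use x in auto)

lemma int_pow_cases:
  fixes n :: int
  assumes x: "x \<in> carrier G"
  shows "f (x [^]\<^bsub>G\<^esub> n) \<in> {f x [^]\<^bsub>H\<^esub> n, inv\<^bsub>H\<^esub> (f x [^]\<^bsub>H\<^esub> n)}"
proof (cases n rule: int_cases2)
  case (nonneg k)
  then show ?thesis
    using nat_pow_cases[OF x, of k] by (simp add: int_pow_int)
next
  case (nonpos k)
  then show ?thesis
    using nat_pow_cases[OF x, of k] inv_cases[of "x [^]\<^bsub>G\<^esub> k"] x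
    by (auto simp: G.int_pow_neg_int H.int_pow_neg_int)
qed

text \<open>
  The homomorphism maps the generator \<open>c\<close> to \<open>y = f (e c)\<close>. It is well defined because a relation
  \<open>c\<^sup>n = \<one>\<close> forces \<open>y\<^sup>n\<close> to be the image of \<open>\<one>\<close> up to inversion, that is, \<open>\<one>\<close>.
\<close>

lemma cyclic_hom:
  assumes "group C" "cyclic_group C" and e: "e \<in> hom C G"
  obtains h where "h \<in> hom C H" "\<And>a. a \<in> carrier C \<Longrightarrow> f (e a) \<in> {h a, inv\<^bsub>H\<^esub> h a}"
proof -
  interpret C: group C by fact
  interpret e: group_hom C G e
    using e by unfold_locales
  obtain c where c: "c \<in> carrier C" and gen: "carrier C = range (\<lambda>n::int. c [^]\<^bsub>C\<^esub> n)"
    using assms(2) by (auto simp: C.cyclic_group)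
  define y where "y = f (e c)"
  have y: "y \<in> carrier H"
    using c by (simp add: y_def)
  define h where "h a = y [^]\<^bsub>H\<^esub> (SOME n::int. a = c [^]\<^bsub>C\<^esub> n)" for a
  have pow_cong: "y [^]\<^bsub>H\<^esub> m = y [^]\<^bsub>H\<^esub> n" if "c [^]\<^bsub>C\<^esub> m = c [^]\<^bsub>C\<^esub> n" for m n :: int
  proof -
    have "c [^]\<^bsub>C\<^esub> (m - n) = \<one>\<^bsub>C\<^esub>"
      using that c by (simp add: C.int_pow_diff)
    then have "e c [^]\<^bsub>G\<^esub> (m - n) = \<one>\<^bsub>G\<^esub>"
      using c by (metis e.hom_one e.hom_int_pow)
    then have "y [^]\<^bsub>H\<^esub> (m - n) = \<one>\<^bsub>H\<^esub>"
      using int_pow_cases[of "e c" "m - n"] c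
      by (simp add: y_def eq_commute[of "\<one>\<^bsub>H\<^esub>"] H.inv_eq_1_iff)
    then have "y [^]\<^bsub>H\<^esub> m \<otimes>\<^bsub>H\<^esub> inv\<^bsub>H\<^esub> (y [^]\<^bsub>H\<^esub> n) = \<one>\<^bsub>H\<^esub>"
      using y by (simp add: H.int_pow_diff)
    then show ?thesis
      using y by (metis H.int_pow_closed H.inv_closed H.inv_equality H.inv_inv)
  qed
  have h_pow: "h (c [^]\<^bsub>C\<^esub> n) = y [^]\<^bsub>H\<^esub> n" for n :: int
    unfolding h_def by (rule pow_cong) (rule someI[of "\<lambda>m. c [^]\<^bsub>C\<^esub> n = c [^]\<^bsub>C\<^esub> m", symmetric], simp)
  show ?thesis
  proof
    show "h \<in> hom C H"
    proof (rule homI)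
      fix a b assume "a \<in> carrier C" "b \<in> carrier C"
      then obtain m n :: int where [simp]: "a = c [^]\<^bsub>C\<^esub> m" "b = c [^]\<^bsub>C\<^esub> n"
        unfolding gen by blast
      have "a \<otimes>\<^bsub>C\<^esub> b = c [^]\<^bsub>C\<^esub> (m + n)"
        using c by (simp add: C.int_pow_mult)
      then show "h (a \<otimes>\<^bsub>C\<^esub> b) = h a \<otimes>\<^bsub>H\<^esub> h b"
        using y by (simp only: h_pow) (simp add: h_pow H.int_pow_mult)
    qed (use y in \<open>auto simp: h_def\<close>)
    fix a assume "a \<in> carrier C"
    then obtain n :: int where "a = c [^]\<^bsub>C\<^esub> n"
      unfolding gen by blast
    then show "f (e a) \<in> {h a, inv\<^bsub>H\<^esub> h a}"
      using int_pow_cases[of "e c" n] c by (simp add: h_pow y_def e.hom_int_pow)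
  qed
qed

end

section \<open>Direct sums of cyclic groups\<close>

lemma comm_group_sum_group:
  assumes "\<And>i. i \<in> I \<Longrightarrow> comm_group (C i)"
  shows "comm_group (sum_group I C)"
proof -
  have grp: "\<And>i. i \<in> I \<Longrightarrow> group (C i)"
    using assms comm_group.axioms(2) by blast
  interpret group "sum_group I C"
    using grp by simp
  show ?thesis
  proof
    fix x y assume "x \<in> carrier (sum_group I C)" "y \<in> carrier (sum_group I C)"
    then show "x \<otimes>\<^bsub>sum_group I C\<^esub> y = y \<otimes>\<^bsub>sum_group I C\<^esub> x"
      using assms by (auto simp: carrier_sum_group grp PiE_iff intro!: restrict_ext comm_monoid.m_comm comm_group.axioms(1))
  qed
qed

definition single_summand :: "'i set \<Rightarrow> ('i \<Rightarrow> ('c, 'z) monoid_scheme) \<Rightarrow> 'i \<Rightarrow> 'c \<Rightarrow> 'i \<Rightarrow> 'c" where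
  "single_summand I C i a = (\<lambda>j\<in>I. if j = i then a else \<one>\<^bsub>C j\<^esub>)"

lemma single_summand_hom:
  assumes grp: "\<And>i. i \<in> I \<Longrightarrow> group (C i)" and i: "i \<in> I"
  shows "single_summand I C i \<in> hom (C i) (sum_group I C)"
proof (rule homI)
  fix a b assume a: "a \<in> carrier (C i)" and b: "b \<in> carrier (C i)"
  have "{j \<in> I. single_summand I C i a j \<noteq> \<one>\<^bsub>C j\<^esub>} \<subseteq> {i}"
    by (auto simp: single_summand_def)
  then have "finite {j \<in> I. single_summand I C i a j \<noteq> \<one>\<^bsub>C j\<^esub>}"
    by (rule finite_subset) simp
  then show "single_summand I C i a \<in> carrier (sum_group I C)"
    using a grp by (auto simp: carrier_sum_group single_summand_def group.is_monoid)
  show "single_summand I C i (a \<otimes>\<^bsub>C i\<^esub> b) =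
      single_summand I C i a \<otimes>\<^bsub>sum_group I C\<^esub> single_summand I C i b"
    using grp by (auto simp: single_summand_def group.is_monoid intro!: restrict_ext)
qed

text \<open>
  The isomorphism \<open>\<theta>\<close> is the sum of homomorphisms \<open>h\<^sub>i\<close> that agree with \<open>f\<close> up to sign on the single
  summands. The relation \<open>same x y\<close> says that \<open>y\<close> arises from \<open>x\<close> by changing signs of
  coordinates. Both halves of the claim \<open>signs\<close> are proved by removing one coordinate \<open>d\<close>
  from \<open>x\<close>: up to signs, \<open>f x\<close> is the sum of \<open>f x'\<close> and \<open>f d = \<plusminus>\<theta> d\<close>, and these signs are
  absorbed by the coordinates of the argument, since \<open>x'\<close> and \<open>d\<close> have disjoint supports.
\<close>

lemma sum_of_cyclic_groups_iso:
  fixes I :: "'i set" and C :: "'i \<Rightarrow> ('c, 'z) monoid_scheme"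
  assumes cyc: "\<And>i. i \<in> I \<Longrightarrow> group (C i) \<and> cyclic_group (C i)"
    and "zero_sum_bijection (sum_group I C) H f"
  shows "sum_group I C \<cong> H"
proof -
  let ?S = "sum_group I C" and ?e = "single_summand I C"
  interpret zero_sum_bijection ?S H f by fact
  have grp: "group (C i)" if "i \<in> I" for i
    using cyc that by blast
  have e: "?e i \<in> hom (C i) ?S" if "i \<in> I" for i
    using grp that by (rule single_summand_hom)
  have "\<exists>h. h \<in> hom (C i) H \<and> (\<forall>a\<in>carrier (C i). f (?e i a) \<in> {h a, inv\<^bsub>H\<^esub> h a})" if i: "i \<in> I" for i
    using cyclic_hom[OF _ _ e[OF i]] cyc[OF i] by metis
  then obtain h where h: "\<And>i. i \<in> I \<Longrightarrow> h i \<in> hom (C i) H"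
    and h_sign: "\<And>i a. \<lbrakk>i \<in> I; a \<in> carrier (C i)\<rbrakk> \<Longrightarrow> f (?e i a) \<in> {h i a, inv\<^bsub>H\<^esub> h i a}"
    by metis
  have h_closed: "h i a \<in> carrier H" if "i \<in> I" "a \<in> carrier (C i)" for i a
    using h that by (auto simp: hom_def)
  define \<theta> where "\<theta> x = gfinprod H (\<lambda>i. h i (x i)) I" for x
  have \<theta>_hom: "\<theta> \<in> hom ?S H"
    unfolding \<theta>_def using h grp by (rule H.hom_group_sum)
  interpret \<theta>: group_hom ?S H \<theta>
    using \<theta>_hom by unfold_locales
  have \<theta>_single: "\<theta> (?e i a) = h i a" if i: "i \<in> I" and a: "a \<in> carrier (C i)" for i a
  proof -
    have "\<theta> (?e i a) = gfinprod H (\<lambda>i. h i (?e i a i)) {i}"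
      unfolding \<theta>_def
    proof (rule H.gfinprod_mono_neutral_cong_right)
      show "h j (?e i a j) = \<one>\<^bsub>H\<^esub>" if "j \<in> I - {i}" for j
        using that hom_one[OF h grp H.is_group, of j] by (auto simp: single_summand_def)
    qed (use i a h_closed grp in \<open>auto simp: single_summand_def group.is_monoid\<close>)
    also have "\<dots> = h i a"
      using i a h_closed by (simp add: single_summand_def)
    finally show ?thesis .
  qed
  define same where "same x y \<longleftrightarrow> y \<in> carrier ?S \<and> (\<forall>i\<in>I. y i \<in> {x i, inv\<^bsub>C i\<^esub> x i})" for x y
  have comp: "x i \<in> carrier (C i)" if "x \<in> carrier ?S" "i \<in> I" for x i
    using that grp by (auto simp: carrier_sum_group)
  have signs: "(\<exists>y. same x y \<and> \<theta> y = f x) \<and> (\<exists>y. same x y \<and> f y = \<theta> x)"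
    if "finite J" "x \<in> carrier ?S" "\<And>i. i \<in> I \<Longrightarrow> i \<notin> J \<Longrightarrow> x i = \<one>\<^bsub>C i\<^esub>" for J x
    using that
  proof (induction J arbitrary: x rule: finite_induct)
    case empty
    then have "x = \<one>\<^bsub>?S\<^esub>"
      using grp by (auto simp: carrier_sum_group PiE_iff extensional_def fun_eq_iff)
    moreover have "same \<one>\<^bsub>?S\<^esub> \<one>\<^bsub>?S\<^esub>"
      using G.one_closed by (simp add: same_def)
    ultimately show ?case
      using one \<theta>.hom_one by metis
  next
    case (insert i J)
    show ?case
    proof (cases "i \<in> I")
      case False
      then have "x j = \<one>\<^bsub>C j\<^esub>" if "j \<in> I" "j \<notin> J" for j
        using insert.prems(2) that by auto
      with insert.prems(1) show ?thesis
        by (rule insert.IH)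
    next
      case i: True
      define x' where "x' = (\<lambda>j\<in>I. if j = i then \<one>\<^bsub>C j\<^esub> else x j)"
      define d where "d = ?e i (x i)"
      have xi: "x i \<in> carrier (C i)"
        using insert.prems(1) i by (rule comp)
      have d: "d \<in> carrier ?S"
        unfolding d_def using e[OF i] xi by (auto simp: hom_def)
      have "finite {j \<in> I. x j \<noteq> \<one>\<^bsub>C j\<^esub>}"
        using insert.prems(1) grp by (simp add: carrier_sum_group)
      then have "finite {j \<in> I. x' j \<noteq> \<one>\<^bsub>C j\<^esub>}"
        by (rule rev_finite_subset) (auto simp: x'_def)
      then have x': "x' \<in> carrier ?S"
        using insert.prems(1) grp by (auto simp: carrier_sum_group x'_def group.is_monoid)
      have split: "x = x' \<otimes>\<^bsub>?S\<^esub> d"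
        using insert.prems(1) grp xi comp[OF insert.prems(1)]
        by (auto simp: x'_def d_def single_summand_def fun_eq_iff carrier_sum_group PiE_iff extensional_def group.is_monoid)
      \<comment> \<open>outside coordinate \<open>i\<close> the factor \<open>d\<close> is trivial, and at \<open>i\<close> the factor \<open>y\<close> is\<close>
      have same_mult: "same x z"
        if y: "same x' y" and z: "z \<in> signed_pair ?S y d"
        for y z
      proof -
        have yS: "y \<in> carrier ?S"
          using y by (simp add: same_def)
        then have "z \<in> carrier ?S"
          using z d by (auto simp del: mult_sum_group)
        moreover have "z j \<in> {x j, inv\<^bsub>C j\<^esub> x j}" if j: "j \<in> I" for j
        proof -
          interpret Cj: group "C j"
            using grp j .
          have coords: "z j \<in> signed_pair (C j) (y j) (d j)"
            using z j grp yS d by (auto simp: inv_sum_group)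
          have yj: "y j \<in> {x' j, inv\<^bsub>C j\<^esub> x' j}"
            using y j by (simp add: same_def)
          have xj: "x j \<in> carrier (C j)"
            using insert.prems(1) j by (rule comp)
          show ?thesis
          proof (cases "j = i")
            case True
            then have "y j = \<one>\<^bsub>C j\<^esub>" "d j = x j"
              using yj j Cj.inv_one by (auto simp: x'_def d_def single_summand_def)
            then show ?thesis
              using coords xj by auto
          next
            case False
            then have "y j \<in> {x j, inv\<^bsub>C j\<^esub> x j}" "d j = \<one>\<^bsub>C j\<^esub>"
              using yj j by (auto simp: x'_def d_def single_summand_def)
            then show ?thesis
              using coords xj by auto
          qed
        qed
        ultimately show ?thesis
          by (simp add: same_def)
      qed
      have outside: "x' j = \<one>\<^bsub>C j\<^esub>" if "j \<in> I" "j \<notin> J" for j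
        using insert.prems(2) that by (auto simp: x'_def)
      obtain y where y: "same x' y" "\<theta> y = f x'"
        using insert.IH[OF x' outside] by blast
      obtain y' where y': "same x' y'" "f y' = \<theta> x'"
        using insert.IH[OF x' outside] by blast
      have yS: "y \<in> carrier ?S" "y' \<in> carrier ?S"
        using y(1) y'(1) by (simp_all add: same_def)
      have \<theta>d: "f d \<in> {\<theta> d, inv\<^bsub>H\<^esub> \<theta> d}"
        unfolding d_def \<theta>_single[OF i xi] using h_sign[OF i xi] .
      have "f x \<in> signed_pair H (f x') (f d)"
        unfolding split using x' d by (rule mult_cases)
      then have "f x \<in> signed_pair H (\<theta> y) (\<theta> d)"
        using \<theta>d \<theta>.hom_closed[OF d] unfolding y(2) by auto
      then have "f x \<in> \<theta> ` signed_pair ?S y d"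
        using yS d by (simp only: image_insert image_empty \<theta>.hom_mult \<theta>.hom_inv G.inv_closed)
      then obtain z where "\<theta> z = f x" "z \<in> signed_pair ?S y d"
        by (rule imageE) (rule that, rule sym)
      then have first: "\<exists>z. same x z \<and> \<theta> z = f x"
        using same_mult[OF y(1)] by (intro exI[of _ z] conjI)
      have "\<theta> d \<in> {f d, inv\<^bsub>H\<^esub> f d}"
        using \<theta>d \<theta>.hom_closed[OF d] by auto
      then obtain z where fz: "f z = f y' \<otimes>\<^bsub>H\<^esub> \<theta> d"
        and z: "z \<in> signed_pair ?S y' d"
        by (rule mult_preimage[OF yS(2) d])
      have "\<theta> x = f y' \<otimes>\<^bsub>H\<^esub> \<theta> d"
        unfolding split y'(2) using x' d by (rule \<theta>.hom_mult)
      then have "\<exists>z. same x z \<and> f z = \<theta> x"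
        using same_mult[OF y'(1) z] fz by (intro exI[of _ z] conjI) simp_all
      with first show ?thesis ..
    qed
  qed
  have support: "finite {i \<in> I. x i \<noteq> \<one>\<^bsub>C i\<^esub>}" if "x \<in> carrier ?S" for x
    using that grp by (simp add: carrier_sum_group)
  have \<theta>_to_f: "\<exists>y. same x y \<and> \<theta> y = f x" and f_to_\<theta>: "\<exists>y. same x y \<and> f y = \<theta> x"
    if "x \<in> carrier ?S" for x
    using signs[OF support[OF that] that] by auto
  have "\<theta> ` carrier ?S = carrier H"
  proof (intro subset_antisym subsetI)
    fix u assume "u \<in> carrier H"
    then obtain x where "x \<in> carrier ?S" "f x = u"
      using surj by blast
    then show "u \<in> \<theta> ` carrier ?S"
      using \<theta>_to_f[of x] unfolding same_def by (metis imageI)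
  qed (erule imageE, simp only: \<theta>.hom_closed)
  moreover have "inj_on \<theta> (carrier ?S)"
    unfolding \<theta>.inj_on_one_iff
  proof (intro allI impI)
    fix x assume x: "x \<in> carrier ?S" and "\<theta> x = \<one>\<^bsub>H\<^esub>"
    then obtain y where y: "same x y" "f y = \<one>\<^bsub>H\<^esub>"
      using f_to_\<theta> by metis
    then have "y = \<one>\<^bsub>?S\<^esub>"
      using eq_iff[of y "\<one>\<^bsub>?S\<^esub>"] G.one_closed unfolding one by (simp add: same_def)
    then have "\<one>\<^bsub>C i\<^esub> \<in> {x i, inv\<^bsub>C i\<^esub> x i}" if "i \<in> I" for i
      using y(1) that by (auto simp: same_def)
    then have "x i = \<one>\<^bsub>C i\<^esub>" if "i \<in> I" for i
      using that comp[OF x that] grp[OF that] by (metis group.inv_eq_1_iff insertE singletonD)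
    then show "x = \<one>\<^bsub>?S\<^esub>"
      using x grp by (auto simp: carrier_sum_group PiE_iff extensional_def fun_eq_iff)
  qed
  ultimately have "\<theta> \<in> iso ?S H"
    using \<theta>_hom by (simp add: iso_def bij_betw_def)
  then show ?thesis
    by (rule is_isoI)
qed

section \<open>Recovering the group from the monoid\<close>

text \<open>
  If the image of \<open>S\<close> lies in the monoid over \<open>H\<close>, it is \<open>\<phi> A\<close> for some \<open>A\<close>, and \<open>A = S\<close> because both
  have the same image under the injective map \<open>base\<close>.
\<close>

lemma (in pm_iso) zero_sum_bijection_base:
  assumes one: "\<phi> {#\<one>\<^bsub>G\<^esub>#} = {#\<one>\<^bsub>H\<^esub>#}"
  shows "zero_sum_bijection G H base"
proof unfold_locales
  show "bij_betw base (carrier G) (carrier H)"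
    by (rule bij_betw_base)
  fix S assume S: "set_mset S \<subseteq> carrier G"
  show "pm_zero_sum H (image_mset base S) \<longleftrightarrow> pm_zero_sum G S"
  proof
    assume "pm_zero_sum G S"
    then have "S \<in> BG"
      using S by (simp add: carrier_pm_zero_sum_monoid)
    then have "image_mset base S \<in> BH"
      using closed[of S] by (simp only: induced_by_bijection[OF one])
    then show "pm_zero_sum H (image_mset base S)"
      by (simp add: carrier_pm_zero_sum_monoid)
  next
    assume "pm_zero_sum H (image_mset base S)"
    then have "image_mset base S \<in> BH"
      using S square(3) by (auto simp: carrier_pm_zero_sum_monoid)
    then obtain A where A: "A \<in> BG" "\<phi> A = image_mset base S"
      using surj by blast
    then have "image_mset base A = image_mset base S"
      by (simp only: induced_by_bijection[OF one])
    then have "image_mset (inv_into (carrier G) base) (image_mset base A) =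
        image_mset (inv_into (carrier G) base) (image_mset base S)"
      by simp
    moreover have "image_mset (inv_into (carrier G) base) (image_mset base T) = T"
      if "set_mset T \<subseteq> carrier G" for T
      using that by (induction T) (simp_all add: inv_into_f_f[OF inj_on_base])
    ultimately have "A = S"
      using S A(1) by (simp add: carrier_pm_zero_sum_monoid)
    then show "pm_zero_sum G S"
      using A(1) by (simp add: carrier_pm_zero_sum_monoid)
  qed
qed

theorem theorem4p3:
  fixes G1 :: "('a, 'x) monoid_scheme"
    and G2 :: "('b, 'y) monoid_scheme"
    and I :: "'i set"
    and C :: "'i \<Rightarrow> 'c monoid"
  assumes "comm_group G1"
    and "comm_group G2"
    and "\<And>i. i \<in> I \<Longrightarrow> group (C i) \<and> cyclic_group (C i)"
    and "G1 \<cong> sum_group I C"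
  shows "G1 \<cong> G2 \<longleftrightarrow> pm_zero_sum_monoid G1 \<cong> pm_zero_sum_monoid G2"
proof
  assume "G1 \<cong> G2"
  with assms(1,2) show "pm_zero_sum_monoid G1 \<cong> pm_zero_sum_monoid G2"
    by (rule pm_zero_sum_monoid_iso)
next
  assume monoids: "pm_zero_sum_monoid G1 \<cong> pm_zero_sum_monoid G2"
  let ?S = "sum_group I C"
  have S: "comm_group ?S"
    using assms(3) by (intro comm_group_sum_group group.cyclic_imp_abelian_group) auto
  \<comment> \<open>the coordinates of the direct sum are needed, so \<open>G1\<close> is replaced by \<open>sum_group I C\<close>\<close>
  have "?S \<cong> G1"
    using comm_group.axioms(2)[OF assms(1)] assms(4) by (rule group.iso_sym)
  then have "pm_zero_sum_monoid ?S \<cong> pm_zero_sum_monoid G1"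
    by (rule pm_zero_sum_monoid_iso[OF S assms(1)])
  then have "pm_zero_sum_monoid ?S \<cong> pm_zero_sum_monoid G2"
    using monoids by (rule iso_trans)
  then obtain \<phi> where "\<phi> \<in> iso (pm_zero_sum_monoid ?S) (pm_zero_sum_monoid G2)"
    by (auto simp: is_iso_def)
  then interpret pm_iso ?S G2 \<phi>
    using S assms(2) by (simp add: pm_iso_def pm_iso_axioms_def)
  have "?S \<cong> G2"
  proof (cases "\<phi> {#\<one>\<^bsub>?S\<^esub>#} = {#\<one>\<^bsub>G2\<^esub>#}")
    case True
    show ?thesis
      using assms(3) zero_sum_bijection_base[OF True] by (rule sum_of_cyclic_groups_iso)
  next
    case False
    then obtain h where "h \<noteq> \<one>\<^bsub>G2\<^esub>" "carrier G2 = {\<one>\<^bsub>G2\<^esub>, h}"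
      using identity_or_order_two by blast
    with G.is_group H.is_group bij_betw_base show ?thesis
      by (rule order_two_groups_iso)
  qed
  with assms(4) show "G1 \<cong> G2"
    by (rule iso_trans)
qed

end
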